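(* Let $n \in \mathbb{N}$, $n \geq 1$. For every collection $\mu_1, \ldots, \mu_n$ of compactly-supported nonzero positive finite Borel measures on $\mathbb{R}^n$ there exists a hyperplane $H$ in $\mathbb{R}^n$ such that for each $1 \leq i \leq n$, $H$ bisects $\mu_i$ and $H \cap \operatorname{supp}(\mu_i) \neq \emptyset$.
   Context: A hyperplane in $\mathbb{R}^n$ means an $(n-1)$-dimensional affine hyperplane $H = \{x \in \mathbb{R}^n : \langle u, x\rangle = c\}$, where $u \in \mathbb{R}^n$ with $|u| = 1$, $c \geq 0$, and $\langle\cdot,\cdot\rangle$ is the standard inner product. Its two open half-spaces are $H^+ = \{x \in \mathbb{R}^n: \langle u,x\rangle > c\}$ and $H^- = \{x \in \mathbb{R}^n : \langle u,x\rangle < c\}$. For a finite Borel measure $\mu$ on $\mathbb{R}^n$, $\|\mu\| = \mu(\mathbb{R}^n)$ denotes its total mass, and $\operatorname{supp}(\mu)$ denotes its support, i.e. the smallest closed set $C \subset \mathbb{R}^n$ such that $\mu(C) = \|\mu\|$. The hyperplane $H$ bisects a positive finite Borel measure $\mu$ on $\mathbb{R}^n$ if $\mu(H^+) \leq \|\mu\|/2$ and $\mu(H^-) \leq \|\mu\|/2$. *)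

theory Defs
  imports "HOL-Analysis.Analysis"
begin

definition finite_borel_measure :: "'a::topological_space measure \<Rightarrow> bool" where
  "finite_borel_measure M \<longleftrightarrow> sets M = sets borel \<and> finite_measure M"

(* LEAST is taken with respect to set inclusion; msupport_least below shows that
   the smallest closed set of full measure exists. *)
definition msupport :: "'a::topological_space measure \<Rightarrow> 'a set" where
  "msupport M = (LEAST C. closed C \<and> measure M C = measure M UNIV)"

definition hyperplane :: "'a::real_inner \<Rightarrow> real \<Rightarrow> 'a set" where
  "hyperplane u c = {x. u \<bullet> x = c}"

definition pos_side :: "'a::real_inner \<Rightarrow> real \<Rightarrow> 'a set" where
  "pos_side u c = {x. u \<bullet> x > c}"

definition neg_side :: "'a::real_inner \<Rightarrow> real \<Rightarrow> 'a set" where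
  "neg_side u c = {x. u \<bullet> x < c}"

definition bisects :: "'a::real_inner \<Rightarrow> real \<Rightarrow> 'a measure \<Rightarrow> bool" where
  "bisects u c M \<longleftrightarrow>
     measure M (pos_side u c) \<le> measure M UNIV / 2 \<and>
     measure M (neg_side u c) \<le> measure M UNIV / 2"

lemma msupport_least:
  fixes M :: "'a::second_countable_topology measure"
  assumes "finite_borel_measure M"
  shows "closed (msupport M)"
    and "measure M (msupport M) = measure M UNIV"
    and "\<And>C. closed C \<Longrightarrow> measure M C = measure M UNIV \<Longrightarrow> msupport M \<subseteq> C"
proof -
  interpret finite_measure M using assms by (simp add: finite_borel_measure_def)
  have sets_M [measurable_cong]: "sets M = sets borel"
    using assms by (simp add: finite_borel_measure_def)
  have space_M: "space M = UNIV"
    using sets_eq_imp_space_eq[OF sets_M] by simp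
  define F where "F = {C. closed C \<and> measure M C = measure M UNIV}"
  have closed_F: "closed (\<Inter>F)" by (auto simp: F_def)
  obtain G where G: "G \<subseteq> uminus ` F" "countable G" "\<Union>G = \<Union>(uminus ` F)"
    using Lindelof[of "uminus ` F"] by (auto simp: F_def)
  have "D \<in> null_sets M" if D: "D \<in> G" for D
  proof -
    obtain C where C: "closed C" "measure M C = measure M UNIV" "D = - C"
      using D G(1) by (auto simp: F_def)
    have "C \<in> sets M" using C(1) by (simp add: sets_M borel_closed)
    moreover from this have "measure M (space M - C) = 0"
      using finite_measure_compl C(2) space_M by simp
    ultimately show ?thesis
      using C(3) space_M by (auto simp: null_sets_def emeasure_eq_measure Compl_eq_Diff_UNIV)
  qed
  then have null: "\<Union>G \<in> null_sets M"
    using null_sets_UN'[OF G(2), of "\<lambda>D. D" M] by simp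
  have eq: "\<Inter>F = space M - \<Union>G" using G(3) space_M by auto
  have full_F: "measure M (\<Inter>F) = measure M UNIV"
    using null unfolding eq
    by (subst finite_measure_compl) (auto simp: space_M null_sets_def measure_def)
  have least: "msupport M = \<Inter>F"
    unfolding msupport_def
    by (rule Least_equality) (use closed_F full_F in \<open>auto simp: F_def\<close>)
  show "closed (msupport M)" "measure M (msupport M) = measure M UNIV"
    using least closed_F full_F by simp_all
  show "msupport M \<subseteq> C" if "closed C" "measure M C = measure M UNIV" for C
    unfolding least using that by (auto simp: F_def)
qed

end

theory Submission
  imports Defs "HOL-Homology.Invariance_of_Domain"
begin

text \<open>
  A pair \<open>(u, c)\<close> of norm 1 with \<open>u \<noteq> 0\<close> describes the hyperplane \<open>u \<bullet> x = c\<close>, and \<open>(- u, - c)\<close> describes the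
  same hyperplane with its sides exchanged. The difference of the masses of the two sides is
  therefore an odd function of \<open>(u, c)\<close>, and \<open>n\<close> measures give an odd map from the \<open>n\<close>-sphere to
  \<open>n\<close>-space. If it is continuous, the Borsuk--Ulam theorem provides a zero, that is, a common bisector.

  Two obstacles remain. The difference of masses is discontinuous when hyperplanes carry mass, and
  a bisector may run through a gap of a support without touching it. For the first, the sign of
  \<open>u \<bullet> x - c\<close> is replaced by a continuous odd ramp that is saturated outside the slab
  \<open>\<bar>u \<bullet> x - c\<bar> < 1 / k\<close>. For the second, each measure receives an additional atom of small weight
  \<open>\<delta>\<close> at a point of its support. If the slab misses the support \<open>K\<close>, then the hyperplane cuts \<open>K\<close>
  into two relatively clopen pieces, and balance means that their masses differ by exactly \<open>\<delta>\<close>.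
  A compact metrizable set has only countably many clopen pieces, so \<open>\<delta>\<close> can be chosen to exclude
  this (\<open>approximate_bisector\<close>). As \<open>k\<close> grows, a subsequence of the pairs \<open>(u, c)\<close> converges; the limit
  hyperplane meets every support by compactness (\<open>hyperplane_meets_limit\<close>) and bisects every measure
  by dominated convergence (\<open>bisects_limit\<close>).

  The Borsuk--Ulam theorem (\<open>Borsuk_Ulam_zero\<close>) follows from the fact that an odd self-map of a sphere
  has odd degree (\<open>odd_sphere_degree\<close>): an odd map without zeros into a space of smaller dimension
  would yield a nonsurjective odd self-map of the sphere, which has degree 0. The oddness of the
  degree is proved by induction on the dimension. The inductive step rests on the theorem
  \<open>Borsuk_odd_mapping_degree_step\<close>, by which an odd map that preserves the equator has the same degree
  modulo 2 as its restriction to the equator. To make the equator invariant, the map is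
  approximated by a differentiable odd map; its image of the equator is too small to cover
  the sphere, and so it can be pushed away from a missed pair of antipodal points.
\<close>

section \<open>Odd approximations that avoid a line\<close>

text \<open>
  Weierstrass approximation gives a polynomial map near \<open>f\<close>, and its odd part is still near \<open>f\<close>.
  After normalization it is differentiable, so it cannot map the lower-dimensional sphere in \<open>S\<close>
  onto the sphere in \<open>T\<close>; because of oddness, a missed point \<open>p\<close> comes with the missed point \<open>- p\<close>,
  and the whole line through \<open>p\<close> is avoided.
\<close>

lemma odd_approximation_avoiding_line:
  fixes f :: "'a::euclidean_space \<Rightarrow> 'a"
  assumes "subspace S" "subspace T" "dim S < dim T" "S \<subseteq> T"
    and contf: "continuous_on (sphere 0 1 \<inter> T) f"
    and fim: "f \<in> sphere 0 1 \<inter> T \<rightarrow> sphere 0 1 \<inter> T"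
    and odd: "\<And>x. x \<in> sphere 0 1 \<inter> T \<Longrightarrow> f (- x) = - f x"
  obtains g p where "continuous_on UNIV g" "g \<in> sphere 0 1 \<inter> T \<rightarrow> T" "\<And>x. g (- x) = - g x"
    "\<And>x. x \<in> sphere 0 1 \<inter> T \<Longrightarrow> norm (f x - g x) < 1"
    "p \<in> sphere 0 1 \<inter> T" "\<And>x c. x \<in> sphere 0 1 \<inter> S \<Longrightarrow> g x \<noteq> c *\<^sub>R p"
proof -
  have "compact (sphere 0 1 \<inter> T)"
    using \<open>subspace T\<close> by (simp add: closed_subspace compact_Int_closed)
  then obtain q where q: "polynomial_function q" "q ` (sphere 0 1 \<inter> T) \<subseteq> T"
      "\<And>x. x \<in> sphere 0 1 \<inter> T \<Longrightarrow> norm (f x - q x) < 1"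
    using Stone_Weierstrass_polynomial_function_subspace[OF _ contf zero_less_one \<open>subspace T\<close>]
      fim by (metis Int_lower2 image_subset_iff_funcset subset_trans)
  define g where "g = (\<lambda>x. (1/2) *\<^sub>R (q x - q (- x)))"
  have neg: "- x \<in> sphere 0 1 \<inter> T" if "x \<in> sphere 0 1 \<inter> T" for x
    using that \<open>subspace T\<close> by (simp add: subspace_neg)
  have gT: "g x \<in> T" if "x \<in> sphere 0 1 \<inter> T" for x
    using q(2) that neg[OF that] \<open>subspace T\<close> unfolding g_def
    by (intro subspace_mul subspace_diff) auto
  have near: "norm (f x - g x) < 1" if x: "x \<in> sphere 0 1 \<inter> T" for x
  proof -
    \<comment> \<open>Oddness of \<open>f\<close> makes the error of \<open>g\<close> an average of two errors of \<open>q\<close>.\<close>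
    have "f x - g x = (1/2) *\<^sub>R ((f x - q x) - (f (- x) - q (- x)))"
      by (simp add: g_def odd[OF x] algebra_simps flip: scaleR_add_left)
    also have "norm \<dots> \<le> (1/2) * (norm (f x - q x) + norm (f (- x) - q (- x)))"
      using norm_triangle_ineq4[of "f x - q x" "f (- x) - q (- x)"] by simp
    also have "\<dots> < 1"
      using q(3)[OF x] q(3)[OF neg[OF x]] by simp
    finally show ?thesis .
  qed
  have g_nz: "g x \<noteq> 0" if "x \<in> sphere 0 1 \<inter> T" for x
  proof -
    have "norm (f x) = 1"
      using fim that by auto
    then show ?thesis
      using near[OF that] by auto
  qed
  have diff_g: "g differentiable_on X" for X
    unfolding g_def
    by (intro differentiable_on_polynomial_function polynomial_function_cmul polynomial_function_diff
        q(1) polynomial_function_compose[OF polynomial_function_minus[OF polynomial_function_id] q(1), unfolded o_def])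
  have contg: "continuous_on UNIV g"
    by (rule differentiable_imp_continuous_on[OF diff_g])
  have g_odd: "g (- x) = - g x" for x
    by (simp add: g_def algebra_simps)
  define n where "n = (\<lambda>x. g x /\<^sub>R norm (g x))"
  have "n differentiable_on sphere 0 1 \<inter> S"
    unfolding n_def
    using g_nz \<open>S \<subseteq> T\<close>
    by (intro derivative_intros differentiable_on_compose[of g _ norm, unfolded o_def] diff_g
        differentiable_on_norm) auto
  then have "n ` (sphere 0 1 \<inter> S) \<noteq> sphere 0 1 \<inter> T"
    by (rule spheremap_lemma1[OF assms(1-4)])
  moreover have "n ` (sphere 0 1 \<inter> S) \<subseteq> sphere 0 1 \<inter> T"
    using gT g_nz \<open>S \<subseteq> T\<close> \<open>subspace T\<close> by (auto simp: n_def subspace_mul subset_iff)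
  ultimately obtain p where p: "p \<in> sphere 0 1 \<inter> T" "p \<notin> n ` (sphere 0 1 \<inter> S)"
    by blast
  have "g x \<noteq> c *\<^sub>R p" if x: "x \<in> sphere 0 1 \<inter> S" for x c
  proof
    assume eq: "g x = c *\<^sub>R p"
    then have "c \<noteq> 0"
      using g_nz x \<open>S \<subseteq> T\<close> by auto
    \<comment> \<open>The normalized value at \<open>x\<close> is \<open>p\<close> or \<open>- p\<close>, so \<open>p\<close> is attained at \<open>x\<close> or at \<open>- x\<close>.\<close>
    have n: "n y = sgn (g y)" for y
      by (simp add: n_def sgn_div_norm)
    have "sgn p = p"
      using p by (simp add: sgn_div_norm)
    have "n x = p \<or> n (- x) = p"
      using \<open>c \<noteq> 0\<close> \<open>sgn p = p\<close> eq by (simp add: n g_odd sgn_minus sgn_scaleR sgn_real_def)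
    moreover have "- x \<in> sphere 0 1 \<inter> S"
      using x \<open>subspace S\<close> by (simp add: subspace_neg)
    ultimately show False
      using p(2) x by blast
  qed
  then show thesis
    using that[of g p] contg gT g_odd near p(1) by blast
qed

text \<open>
  The induction on the dimension takes place inside one Euclidean space, along the flag spanned by
  initial segments of an enumerated basis: the differentiability and approximation results are
  about Euclidean spaces, whereas homology and degree are about the spheres \<open>nsphere m\<close>
  of real sequences. The maps \<open>from_coords\<close> and \<open>coords\<close> translate between the two.
\<close>

locale basis_enumeration =
  fixes b :: "nat \<Rightarrow> 'a::euclidean_space"
  assumes bij_b: "bij_betw b {..<DIM('a)} Basis"
begin

definition flag :: "nat \<Rightarrow> 'a set" where
  "flag m = span (b ` {..m})"

definition fsphere :: "nat \<Rightarrow> 'a set" where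
  "fsphere m = sphere 0 1 \<inter> flag m"

definition from_coords :: "nat \<Rightarrow> (nat \<Rightarrow> real) \<Rightarrow> 'a" where
  "from_coords m x = (\<Sum>i\<le>m. x i *\<^sub>R b i)"

text \<open>
  The entries beyond \<open>m\<close> are 0, as the points of \<open>nsphere m\<close> require.
\<close>

definition coords :: "nat \<Rightarrow> 'a \<Rightarrow> nat \<Rightarrow> real" where
  "coords m y = (\<lambda>i. if i \<le> m then y \<bullet> b i else 0)"

lemma b_in_Basis: "i < DIM('a) \<Longrightarrow> b i \<in> Basis"
  using bij_b by (auto simp: bij_betw_def)

lemma inner_b:
  assumes "i < DIM('a)" "j < DIM('a)"
  shows "b i \<bullet> b j = (if i = j then 1 else 0)"
proof -
  have "b i = b j \<longleftrightarrow> i = j"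
    using bij_b assms by (auto simp: bij_betw_def inj_on_def)
  then show ?thesis
    using assms by (simp add: inner_Basis b_in_Basis)
qed

lemma subspace_flag: "subspace (flag m)"
  by (simp add: flag_def)

lemma b_in_flag: "i \<le> m \<Longrightarrow> b i \<in> flag m"
  by (auto simp: flag_def intro: span_base)

lemma flag_mono: "m \<le> k \<Longrightarrow> flag m \<subseteq> flag k"
  unfolding flag_def by (intro span_mono image_mono) auto

lemma dim_flag:
  assumes "m < DIM('a)"
  shows "dim (flag m) = Suc m"
proof -
  have sub: "{..m} \<subseteq> {..<DIM('a)}"
    using assms by auto
  have "b ` {..m} \<subseteq> Basis"
    using bij_b sub by (auto simp: bij_betw_def)
  then have "independent (b ` {..m})"
    using independent_Basis independent_mono by blast
  then show ?thesis
    unfolding flag_def dim_span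
    using inj_on_subset[OF _ sub, of b] bij_b
    by (simp add: dim_eq_card_independent card_image bij_betw_def)
qed

lemma from_coords_in_flag: "from_coords m x \<in> flag m"
  unfolding from_coords_def
  by (intro subspace_sum subspace_mul subspace_flag b_in_flag) auto

lemma from_coords_inner: "m < DIM('a) \<Longrightarrow> i \<le> m \<Longrightarrow> from_coords m x \<bullet> b i = x i"
  by (simp add: from_coords_def inner_sum_left inner_b if_distrib cong: if_cong)

lemma from_coords_coords:
  assumes "m < DIM('a)" "y \<in> flag m"
  shows "from_coords m (coords m y) = y"
proof (rule linear_eq_on_span[of "\<lambda>y. from_coords m (coords m y)" "\<lambda>y. y" "b ` {..m}"])
  show "linear (\<lambda>y. from_coords m (coords m y))"
    by (rule linearI) (simp_all add: from_coords_def coords_def inner_add_left scaleR_add_left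
        sum.distrib scaleR_sum_right)
  show "from_coords m (coords m y) = y" if "y \<in> b ` {..m}" for y
  proof -
    from that obtain j where "j \<le> m" "y = b j"
      by auto
    then show ?thesis
      using \<open>m < DIM('a)\<close>
      by (simp add: from_coords_def coords_def inner_b if_distrib[of "\<lambda>r. r *\<^sub>R _"] cong: if_cong)
  qed
qed (use assms in \<open>auto simp: flag_def linear_ident\<close>)

lemma norm_from_coords:
  assumes "m < DIM('a)"
  shows "(norm (from_coords m x))\<^sup>2 = (\<Sum>i\<le>m. (x i)\<^sup>2)"
proof -
  have "(norm (from_coords m x))\<^sup>2 = (\<Sum>i\<le>m. x i * (from_coords m x \<bullet> b i))"
    by (simp add: power2_norm_eq_inner) (simp add: from_coords_def inner_sum_right)
  also have "\<dots> = (\<Sum>i\<le>m. (x i)\<^sup>2)"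
    using assms by (intro sum.cong) (auto simp: from_coords_inner power2_eq_square)
  finally show ?thesis .
qed

lemma flag_drop:
  assumes "Suc m < DIM('a)" "y \<in> flag (Suc m)" "y \<bullet> b (Suc m) = 0"
  shows "y \<in> flag m"
proof -
  have "y = from_coords (Suc m) (coords (Suc m) y)"
    using assms by (simp add: from_coords_coords)
  also have "\<dots> = from_coords m (coords m y)"
    using assms(3) by (simp add: from_coords_def coords_def)
  finally show ?thesis
    by (metis from_coords_in_flag)
qed

lemma inner_flag_0:
  assumes "Suc m < DIM('a)" "y \<in> flag m"
  shows "y \<bullet> b (Suc m) = 0"
proof -
  have "flag m \<subseteq> {z. b (Suc m) \<bullet> z = 0}"
    unfolding flag_def using assms(1)
    by (intro span_minimal subspace_hyperplane) (auto simp: inner_b)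
  then show ?thesis
    using assms(2) by (auto simp: inner_commute)
qed

lemma topspace_nsphere_iff:
  "x \<in> topspace (nsphere m) \<longleftrightarrow> (\<Sum>i\<le>m. (x i)\<^sup>2) = 1 \<and> (\<forall>i>m. x i = 0)"
  by (auto simp: nsphere Suc_le_eq)

lemma coords_from_coords: "m < DIM('a) \<Longrightarrow> x \<in> topspace (nsphere m) \<Longrightarrow> coords m (from_coords m x) = x"
  by (auto simp: topspace_nsphere_iff coords_def from_coords_inner)

lemma from_coords_in_fsphere:
  assumes "m < DIM('a)" "x \<in> topspace (nsphere m)"
  shows "from_coords m x \<in> fsphere m"
proof -
  have "(norm (from_coords m x))\<^sup>2 = 1\<^sup>2"
    using assms by (simp add: norm_from_coords topspace_nsphere_iff)
  then have "norm (from_coords m x) = 1"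
    by (rule power2_eq_imp_eq) auto
  then show ?thesis
    by (simp add: fsphere_def from_coords_in_flag)
qed

lemma coords_in_nsphere:
  assumes "m < DIM('a)" "y \<in> fsphere m"
  shows "coords m y \<in> topspace (nsphere m)"
  using assms norm_from_coords[OF assms(1), of "coords m y"]
  by (simp add: topspace_nsphere_iff fsphere_def from_coords_coords) (simp add: coords_def)

lemma continuous_map_from_coords:
  assumes "m < DIM('a)"
  shows "continuous_map (nsphere m) (top_of_set (fsphere m)) (from_coords m)"
proof -
  have "continuous_map (nsphere m) euclidean (\<lambda>x. x i *\<^sub>R b i)" for i
    using continuous_map_compose[OF continuous_map_nsphere_projection, of euclidean "\<lambda>r. r *\<^sub>R b i" m i]
    by (simp add: o_def continuous_on_scaleR)
  then show ?thesis
    using assms unfolding continuous_map_in_subtopology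
    by (auto simp: from_coords_in_fsphere) (auto simp: from_coords_def[abs_def] intro!: continuous_map_sum)
qed

lemma continuous_map_coords:
  assumes "m < DIM('a)"
  shows "continuous_map (top_of_set (fsphere m)) (nsphere m) (coords m)"
proof -
  have "continuous_on (fsphere m) (\<lambda>y. coords m y i)" for i
    by (cases "i \<le> m") (auto simp: coords_def intro!: continuous_intros)
  then show ?thesis
    using assms coords_in_nsphere[OF assms] unfolding nsphere continuous_map_in_subtopology
    by (auto simp: continuous_map_componentwise_UNIV)
qed

section \<open>Odd maps of spheres have odd degree\<close>

definition sphere_degree :: "nat \<Rightarrow> ('a \<Rightarrow> 'a) \<Rightarrow> int" where
  "sphere_degree m F = Brouwer_degree2 m (coords m \<circ> F \<circ> from_coords m)"

lemma continuous_map_transfer: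
  assumes "m < DIM('a)" "continuous_on (fsphere m) F" "F \<in> fsphere m \<rightarrow> fsphere m"
  shows "continuous_map (nsphere m) (nsphere m) (coords m \<circ> F \<circ> from_coords m)"
proof -
  have "continuous_map (top_of_set (fsphere m)) (top_of_set (fsphere m)) F"
    using assms by (simp add: continuous_map_in_subtopology image_subset_iff_funcset)
  then show ?thesis
    by (intro continuous_map_compose[OF continuous_map_from_coords[OF assms(1)]]
        continuous_map_compose[OF _ continuous_map_coords[OF assms(1)]])
qed

lemma sphere_degree_cong:
  assumes "m < DIM('a)" "\<And>x. x \<in> fsphere m \<Longrightarrow> F x = G x"
  shows "sphere_degree m F = sphere_degree m G"
  unfolding sphere_degree_def
  by (rule Brouwer_degree2_eq) (simp add: assms from_coords_in_fsphere)

lemma sphere_degree_id: "m < DIM('a) \<Longrightarrow> sphere_degree m (\<lambda>x. x) = 1"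
  using Brouwer_degree2_eq[of m "coords m \<circ> (\<lambda>x. x) \<circ> from_coords m" id]
  by (simp add: sphere_degree_def coords_from_coords)

lemma sphere_degree_compose:
  assumes m: "m < DIM('a)"
    and F: "continuous_on (fsphere m) F" "F \<in> fsphere m \<rightarrow> fsphere m"
    and G: "continuous_on (fsphere m) G" "G \<in> fsphere m \<rightarrow> fsphere m"
  shows "sphere_degree m (G \<circ> F) = sphere_degree m G * sphere_degree m F"
proof -
  have "sphere_degree m (G \<circ> F)
      = Brouwer_degree2 m ((coords m \<circ> G \<circ> from_coords m) \<circ> (coords m \<circ> F \<circ> from_coords m))"
    unfolding sphere_degree_def
  proof (rule Brouwer_degree2_eq)
    fix x assume "x \<in> topspace (nsphere m)"
    then have "F (from_coords m x) \<in> flag m"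
      using F(2) from_coords_in_fsphere[OF m] by (auto simp: fsphere_def)
    then show "(coords m \<circ> (G \<circ> F) \<circ> from_coords m) x
        = ((coords m \<circ> G \<circ> from_coords m) \<circ> (coords m \<circ> F \<circ> from_coords m)) x"
      by (simp add: from_coords_coords m)
  qed
  then show ?thesis
    using Brouwer_degree2_compose continuous_map_transfer[OF m F] continuous_map_transfer[OF m G]
    by (simp add: sphere_degree_def)
qed

lemma sphere_degree_homotopic:
  assumes m: "m < DIM('a)"
    and "homotopic_with_canon (\<lambda>_. True) (fsphere m) (fsphere m) F G"
  shows "sphere_degree m F = sphere_degree m G"
  unfolding sphere_degree_def
proof (rule Brouwer_degree2_homotopic)
  have "homotopic_with (\<lambda>_. True) (top_of_set (fsphere m)) (nsphere m) (coords m \<circ> F) (coords m \<circ> G)"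
    using assms(2) continuous_map_coords[OF m] by (rule homotopic_with_compose_continuous_map_left) simp
  then show "homotopic_with (\<lambda>_. True) (nsphere m) (nsphere m)
      (coords m \<circ> F \<circ> from_coords m) (coords m \<circ> G \<circ> from_coords m)"
    using continuous_map_from_coords[OF m] by (rule homotopic_with_compose_continuous_map_right) simp
qed

lemma sphere_degree_nonsurjective:
  assumes m: "m < DIM('a)" and F: "continuous_on (fsphere m) F" "F \<in> fsphere m \<rightarrow> fsphere m"
    and "p \<in> fsphere m" "p \<notin> F ` fsphere m"
  shows "sphere_degree m F = 0"
  unfolding sphere_degree_def
proof (rule Brouwer_degree2_nonsurjective[OF continuous_map_transfer[OF m F]])
  have "coords m p \<notin> (coords m \<circ> F \<circ> from_coords m) ` topspace (nsphere m)"
  proof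
    assume "coords m p \<in> (coords m \<circ> F \<circ> from_coords m) ` topspace (nsphere m)"
    then obtain x where x: "x \<in> topspace (nsphere m)" "coords m p = coords m (F (from_coords m x))"
      by auto
    define y where "y = from_coords m x"
    have y: "y \<in> fsphere m" "F y \<in> fsphere m"
      using x(1) from_coords_in_fsphere[OF m] F(2) by (auto simp: y_def)
    have "p = from_coords m (coords m (F y))"
      using x(2) assms(4) from_coords_coords[OF m, of p] by (simp add: y_def fsphere_def)
    also have "\<dots> = F y"
      using y by (simp add: fsphere_def from_coords_coords m)
    finally show False
      using y assms(5) by blast
  qed
  then show "(coords m \<circ> F \<circ> from_coords m) ` topspace (nsphere m) \<noteq> topspace (nsphere m)"
    using coords_in_nsphere[OF m assms(4)] by blast
qed

text \<open>
  Borsuk's degree step, transported to the flag. The equator of \<open>fsphere (Suc m)\<close> is \<open>fsphere m\<close>.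
\<close>

lemma sphere_degree_step:
  assumes m: "Suc m < DIM('a)"
    and F: "continuous_on (fsphere (Suc m)) F" "F \<in> fsphere (Suc m) \<rightarrow> fsphere (Suc m)"
    and odd: "\<And>x. x \<in> fsphere (Suc m) \<Longrightarrow> F (- x) = - F x"
    and equator: "F \<in> fsphere m \<rightarrow> fsphere m"
  shows "even (sphere_degree (Suc m) F - sphere_degree m F)"
proof -
  let ?f = "coords (Suc m) \<circ> F \<circ> from_coords (Suc m)"
  have from_minus: "from_coords k (\<lambda>i. - x i) = - from_coords k x" for k x
    by (simp add: from_coords_def sum_negf)
  have coords_minus: "coords k (- y) = (\<lambda>i. - coords k y i)" for k y
    by (auto simp: coords_def)
  have agree: "?f x = (coords m \<circ> F \<circ> from_coords m) x" if x: "x \<in> topspace (nsphere m)" for x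
  proof -
    have "from_coords (Suc m) x = from_coords m x"
      using x by (simp add: from_coords_def topspace_nsphere_iff)
    moreover have "F (from_coords m x) \<in> flag m"
      using equator from_coords_in_fsphere[OF _ x] m by (auto simp: fsphere_def)
    then have "coords (Suc m) (F (from_coords m x)) = coords m (F (from_coords m x))"
      using inner_flag_0[OF m] by (auto simp: coords_def le_Suc_eq)
    ultimately show ?thesis
      by simp
  qed
  have "even (Brouwer_degree2 (Suc m) ?f - Brouwer_degree2 (Suc m - Suc 0) ?f)"
  proof (rule Borsuk_odd_mapping_degree_step[OF continuous_map_transfer[OF m F]])
    show "(?f \<circ> (\<lambda>x i. - x i)) u = ((\<lambda>x i. - x i) \<circ> ?f) u" if "u \<in> topspace (nsphere (Suc m))" for u
      using odd[OF from_coords_in_fsphere[OF m that]] by (simp add: from_minus coords_minus)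
    show "?f \<in> topspace (nsphere (Suc m - Suc 0)) \<rightarrow> topspace (nsphere (Suc m - Suc 0))"
    proof
      fix x assume "x \<in> topspace (nsphere (Suc m - Suc 0))"
      then have x: "x \<in> topspace (nsphere m)"
        by simp
      have "F (from_coords m x) \<in> fsphere m"
        using equator from_coords_in_fsphere[OF _ x] m by auto
      then show "?f x \<in> topspace (nsphere (Suc m - Suc 0))"
        using agree[OF x] coords_in_nsphere m by simp
    qed
  qed
  moreover have "Brouwer_degree2 m ?f = sphere_degree m F"
    unfolding sphere_degree_def by (rule Brouwer_degree2_eq) (rule agree)
  ultimately show ?thesis
    by (simp add: sphere_degree_def)
qed

text \<open>
  Two maps whose connecting segments avoid the origin are joined by a straight-line homotopy, which
  becomes a homotopy of maps of spheres when it is projected radially by \<open>sgn\<close>.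
\<close>

lemma sphere_degree_sgn_linear_homotopy:
  assumes m: "m < DIM('a)"
    and F: "continuous_on (fsphere m) F" "F \<in> fsphere m \<rightarrow> flag m"
    and G: "continuous_on (fsphere m) G" "G \<in> fsphere m \<rightarrow> flag m"
    and nz: "\<And>x. x \<in> fsphere m \<Longrightarrow> 0 \<notin> closed_segment (F x) (G x)"
  shows "sphere_degree m (sgn \<circ> F) = sphere_degree m (sgn \<circ> G)"
proof (rule sphere_degree_homotopic[OF m])
  have "homotopic_with_canon (\<lambda>_. True) (fsphere m) (flag m - {0}) F G"
  proof (rule homotopic_with_linear[OF F(1) G(1)])
    fix x assume x: "x \<in> fsphere m"
    have "closed_segment (F x) (G x) \<subseteq> flag m"
      using F(2) G(2) x subspace_imp_convex[OF subspace_flag]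
      by (intro closed_segment_subset) auto
    then show "closed_segment (F x) (G x) \<subseteq> flag m - {0}"
      using nz[OF x] by blast
  qed
  moreover have "continuous_on (flag m - {0}) (sgn :: 'a \<Rightarrow> 'a)"
    by (intro continuous_on_sgn continuous_on_id) auto
  moreover have "sgn \<in> flag m - {0} \<rightarrow> fsphere m"
    by (auto simp: fsphere_def norm_sgn sgn_div_norm intro!: subspace_mul subspace_flag)
  ultimately show "homotopic_with_canon (\<lambda>_. True) (fsphere m) (fsphere m) (sgn \<circ> F) (sgn \<circ> G)"
    by (rule homotopic_with_compose_continuous_left)
qed

text \<open>
  Up to a reflection \<open>R\<close>, the map \<open>F\<close> is deformed into an odd map \<open>H\<close> that preserves the equator,
  where the induction hypothesis applies. The degree of \<open>R\<close> need not be known: a factor of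
  an odd product is odd.
\<close>

lemma odd_sphere_degree:
  assumes "m < DIM('a)" "continuous_on (fsphere m) F" "F \<in> fsphere m \<rightarrow> fsphere m"
    and "\<And>x. x \<in> fsphere m \<Longrightarrow> F (- x) = - F x"
  shows "odd (sphere_degree m F)"
  using assms
proof (induction m arbitrary: F)
  case 0
  have S0: "x = b 0 \<or> x = - b 0" if "x \<in> fsphere 0" for x
  proof -
    have "norm (b 0) = 1"
      using b_in_Basis by simp
    moreover from that obtain k where "x = k *\<^sub>R b 0"
      by (auto simp: fsphere_def flag_def span_singleton)
    ultimately show ?thesis
      using that by (auto simp: fsphere_def abs_if split: if_splits)
  qed
  have b0: "b 0 \<in> fsphere 0"
    using b_in_Basis b_in_flag by (simp add: fsphere_def)
  \<comment> \<open>An odd map of two antipodal points is an involution, so the square of its degree is 1.\<close>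
  have "(F \<circ> F) x = x" if "x \<in> fsphere 0" for x
  proof -
    have "F (b 0) = b 0 \<or> F (b 0) = - b 0"
      using S0 b0 "0.prems"(3) by blast
    then show ?thesis
      using S0[OF that] "0.prems"(4)[OF b0] by auto
  qed
  then have "sphere_degree 0 (F \<circ> F) = sphere_degree 0 (\<lambda>x. x)"
    by (rule sphere_degree_cong[OF "0.prems"(1)])
  then have "sphere_degree 0 F * sphere_degree 0 F = 1"
    using sphere_degree_compose[OF "0.prems"(1) "0.prems"(2,3) "0.prems"(2,3)]
      sphere_degree_id[OF "0.prems"(1)] by simp
  then show ?case
    by (metis even_mult_iff odd_one)
next
  case (Suc m)
  let ?n = "Suc m"
  note n = Suc.prems(1)
  have S: "x \<in> fsphere k \<longleftrightarrow> norm x = 1 \<and> x \<in> flag k" for x k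
    by (simp add: fsphere_def)
  have sub: "flag m \<subseteq> flag ?n" "fsphere m \<subseteq> fsphere ?n"
    using flag_mono[of m ?n] by (auto simp: S)
  have dim_less: "dim (flag m) < dim (flag ?n)"
    using n by (simp add: dim_flag)
  obtain g p where g: "continuous_on UNIV g" "g \<in> fsphere ?n \<rightarrow> flag ?n" "\<And>x. g (- x) = - g x"
    and near: "\<And>x. x \<in> fsphere ?n \<Longrightarrow> norm (F x - g x) < 1"
    and p: "p \<in> fsphere ?n" and miss: "\<And>x c. x \<in> fsphere m \<Longrightarrow> g x \<noteq> c *\<^sub>R p"
    using odd_approximation_avoiding_line[OF subspace_flag subspace_flag dim_less sub(1),
        folded fsphere_def, OF Suc.prems(2-4)] by metis
  let ?e = "b ?n"
  have e: "norm ?e = 1" "?e \<in> flag ?n"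
    using b_in_Basis[OF n] by (auto intro: b_in_flag)
  have g_cont: "continuous_on X g" for X
    using g(1) continuous_on_subset by blast
  have seg_Fg: "0 \<notin> closed_segment (F x) (g x)" if x: "x \<in> fsphere ?n" for x
  proof
    assume "0 \<in> closed_segment (F x) (g x)"
    then have "norm (F x - 0) \<le> norm (F x - g x)"
      by (metis dist_in_closed_segment dist_norm norm_minus_commute)
    moreover have "norm (F x) = 1"
      using Suc.prems(3) x S by blast
    ultimately show False
      using near[OF x] by simp
  qed
  then have g_nz: "g x \<noteq> 0" if "x \<in> fsphere ?n" for x
    using that by force
  have "sphere_degree ?n F = sphere_degree ?n (sgn \<circ> F)"
    using Suc.prems(3) by (intro sphere_degree_cong[OF n]) (auto simp: S Pi_iff sgn_div_norm)
  also have "\<dots> = sphere_degree ?n (sgn \<circ> g)"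
    using Suc.prems(2,3) g g_cont seg_Fg
    by (intro sphere_degree_sgn_linear_homotopy[OF n]) (auto simp: S)
  finally have deg_F: "sphere_degree ?n F = sphere_degree ?n (sgn \<circ> g)" .

  \<comment> \<open>The Householder reflection that carries the missed point \<open>p\<close> to the pole \<open>?e\<close>;
    if \<open>p = ?e\<close>, then division by zero makes \<open>R\<close> the identity, as desired.\<close>
  define w where "w = p - ?e"
  define R where "R y = y - (2 * (y \<bullet> w) / (w \<bullet> w)) *\<^sub>R w" for y
  have R_lin: "linear R"
    by (rule linearI) (simp_all add: R_def inner_add_left algebra_simps add_divide_distrib flip: scaleR_add_left)
  have R_norm: "norm (R y) = norm y" for y
  proof -
    define c where "c = 2 * (y \<bullet> w) / (w \<bullet> w)"
    have "c * (w \<bullet> w) = 2 * (y \<bullet> w)"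
      by (cases "w = 0") (simp_all add: c_def)
    then have "(y - c *\<^sub>R w) \<bullet> (y - c *\<^sub>R w) = y \<bullet> y"
      by (simp add: inner_diff_left inner_diff_right inner_commute[of w y] algebra_simps)
    then have "(norm (R y))\<^sup>2 = (norm y)\<^sup>2"
      by (simp add: power2_norm_eq_inner R_def c_def)
    then show ?thesis
      by (simp add: power2_eq_iff_nonneg)
  qed
  have R_p: "R p = ?e"
  proof (cases "w = 0")
    case False
    have "w \<bullet> w = 2 * (p \<bullet> w)"
      using p e by (simp add: w_def S inner_diff_left inner_diff_right inner_commute norm_eq_1)
    then have "2 * (p \<bullet> w) / (w \<bullet> w) = 1"
      using False by (metis divide_self inner_eq_zero_iff)
    then have "R p = p - w"
      by (simp only: R_def scaleR_one)
    then show ?thesis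
      by (simp add: w_def)
  qed (simp add: R_def w_def)
  have R_flag: "R y \<in> flag ?n" if "y \<in> flag ?n" for y
    using that p e unfolding R_def w_def
    by (intro subspace_diff subspace_mul subspace_flag) (auto simp: S)
  have R_inj: "R y = R z \<Longrightarrow> y = z" for y z
    using R_norm[of "y - z"] by (simp add: linear_diff[OF R_lin])
  have R_cont: "continuous_on X R" for X
    using R_lin by (simp add: linear_continuous_on linear_linear)
  define g' where "g' = R \<circ> g"
  have g'_cont: "continuous_on X g'" for X
    unfolding g'_def by (rule continuous_on_compose[OF g_cont R_cont])
  have g'_flag: "g' \<in> fsphere ?n \<rightarrow> flag ?n"
    using g(2) R_flag by (auto simp: g'_def Pi_iff)
  have g'_odd: "g' (- x) = - g' x" for x
    by (simp add: g'_def g(3) linear_neg[OF R_lin])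
  have g'_nz: "g' x \<noteq> 0" if "x \<in> fsphere ?n" for x
    using g_nz[OF that] R_norm[of "g x"] by (auto simp: g'_def)
  have g'_miss: "g' x \<noteq> c *\<^sub>R ?e" if "x \<in> fsphere m" for x c
    using miss[OF that, of c] R_inj[of "g x" "c *\<^sub>R p"] by (auto simp: g'_def R_p linear_scale[OF R_lin])

  \<comment> \<open>The component of \<open>g' x\<close> along the pole is multiplied by the square of the component of \<open>x\<close>.
    The factor is even, so oddness is kept; it vanishes exactly on the equator, where the
    remaining components of \<open>g' x\<close> do not all vanish because \<open>g'\<close> avoids the polar axis.\<close>
  define h where "h x = g' x - ((1 - (x \<bullet> ?e)\<^sup>2) * (g' x \<bullet> ?e)) *\<^sub>R ?e" for x
  have h_cont: "continuous_on X h" for X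
    unfolding h_def by (intro continuous_intros g'_cont)
  have h_flag: "h \<in> fsphere ?n \<rightarrow> flag ?n"
    unfolding h_def using g'_flag e
    by (auto simp: Pi_iff intro!: subspace_diff subspace_mul subspace_flag)
  have h_odd: "h (- x) = - h x" for x
    by (simp add: h_def g'_odd)
  have seg_gh: "0 \<notin> closed_segment (g' x) (h x)" if x: "x \<in> fsphere ?n" for x
  proof
    assume "0 \<in> closed_segment (g' x) (h x)"
    then obtain t where t: "0 \<le> t" "t \<le> 1" "0 = (1 - t) *\<^sub>R g' x + t *\<^sub>R h x"
      by (auto simp: closed_segment_def)
    define s where "s = t * (1 - (x \<bullet> ?e)\<^sup>2)"
    have eq: "g' x = (s * (g' x \<bullet> ?e)) *\<^sub>R ?e"
      using t(3) by (simp add: h_def s_def algebra_simps)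
    show False
    proof (cases "x \<bullet> ?e = 0")
      case True
      then have "x \<in> fsphere m"
        using x flag_drop[OF n] by (simp add: S)
      then show False
        using g'_miss eq by blast
    next
      case False
      then have "0 < t \<Longrightarrow> t * (1 - (x \<bullet> ?e)\<^sup>2) < t * 1"
        by (intro mult_strict_left_mono) auto
      then have "s < 1"
        using t(1,2) unfolding s_def by (cases "t = 0", simp, linarith)
      moreover have "g' x \<bullet> ?e = s * (g' x \<bullet> ?e)"
        using arg_cong[OF eq, of "\<lambda>y. y \<bullet> ?e"] e(1) by (simp add: norm_eq_1)
      ultimately have "g' x \<bullet> ?e = 0"
        by auto
      then show False
        using eq g'_nz[OF x] by auto
    qed
  qed
  have h_nz: "h x \<noteq> 0" if "x \<in> fsphere ?n" for x
    using seg_gh[OF that] by force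
  define H where "H = sgn \<circ> h"
  have H_cont: "continuous_on (fsphere ?n) H"
    unfolding H_def o_def using h_nz by (intro continuous_on_sgn h_cont) auto
  have H_im: "H \<in> fsphere ?n \<rightarrow> fsphere ?n"
    using h_flag h_nz
    by (auto simp: H_def S norm_sgn sgn_div_norm Pi_iff intro!: subspace_mul subspace_flag)
  have H_odd: "H (- x) = - H x" for x
    by (simp add: H_def h_odd sgn_minus)
  have H_equator: "H \<in> fsphere m \<rightarrow> fsphere m"
  proof
    fix x assume x: "x \<in> fsphere m"
    then have "h x \<bullet> ?e = 0"
      using inner_flag_0[OF n, of x] e(1) by (simp add: h_def S inner_diff_left norm_eq_1)
    then have "H x \<bullet> ?e = 0"
      by (simp add: H_def sgn_div_norm)
    moreover have "H x \<in> fsphere ?n"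
      using H_im x sub(2) by blast
    ultimately show "H x \<in> fsphere m"
      using flag_drop[OF n] by (simp add: S)
  qed
  have "odd (sphere_degree m H)"
    using n H_odd H_equator continuous_on_subset[OF H_cont sub(2)] by (intro Suc.IH) auto
  moreover have "even (sphere_degree ?n H - sphere_degree m H)"
    by (rule sphere_degree_step[OF n H_cont H_im H_odd H_equator])
  ultimately have "odd (sphere_degree ?n H)"
    by simp
  moreover have "sphere_degree ?n (sgn \<circ> g') = sphere_degree ?n H"
    unfolding H_def
    by (rule sphere_degree_sgn_linear_homotopy[OF n g'_cont g'_flag h_cont h_flag seg_gh])
  moreover have "sphere_degree ?n (sgn \<circ> g') = sphere_degree ?n (R \<circ> (sgn \<circ> g))"
    by (rule sphere_degree_cong[OF n]) (simp add: g'_def sgn_div_norm R_norm linear_scale[OF R_lin])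
  moreover have "sphere_degree ?n (R \<circ> (sgn \<circ> g)) = sphere_degree ?n R * sphere_degree ?n (sgn \<circ> g)"
  proof (rule sphere_degree_compose[OF n])
    show "continuous_on (fsphere ?n) (sgn \<circ> g)"
      using g_nz unfolding o_def by (intro continuous_on_sgn g_cont) auto
    show "sgn \<circ> g \<in> fsphere ?n \<rightarrow> fsphere ?n"
      using g(2) g_nz by (auto simp: S norm_sgn sgn_div_norm Pi_iff intro!: subspace_mul subspace_flag)
    show "R \<in> fsphere ?n \<rightarrow> fsphere ?n"
      using R_flag by (auto simp: S R_norm)
  qed (rule R_cont)
  ultimately show ?case
    using deg_F by (metis even_mult_iff)
qed

end

text \<open>
  A target of smaller dimension embeds isometrically into the hyperplane orthogonal to a basis vector
  \<open>k\<close>. If \<open>h\<close> had no zero, its normalization would be an odd self-map of the sphere that misses \<open>k\<close>;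
  its degree would be both 0 and odd.
\<close>

theorem Borsuk_Ulam_zero:
  fixes h :: "'a::euclidean_space \<Rightarrow> 'b::euclidean_space"
  assumes dim: "DIM('b) < DIM('a)"
    and cont: "continuous_on (sphere 0 1) h"
    and odd: "\<And>x. norm x = 1 \<Longrightarrow> h (- x) = - h x"
  obtains x where "norm x = 1" "h x = 0"
proof (rule ccontr)
  assume "\<not> thesis"
  then have nz: "\<And>x. norm x = 1 \<Longrightarrow> h x \<noteq> 0"
    using that by blast
  obtain b :: "nat \<Rightarrow> 'a" where b: "bij_betw b {..<DIM('a)} Basis"
    using ex_bij_betw_nat_finite[OF finite_Basis] by (auto simp: atLeast0LessThan)
  interpret basis_enumeration b
    by unfold_locales (rule b)
  define m where "m = DIM('a) - 1"
  have m: "m < DIM('a)" and range_m: "{..m} = {..<DIM('a)}"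
    using dim by (auto simp: m_def)
  have "flag m = UNIV"
    using b by (simp add: flag_def range_m bij_betw_def)
  then have sphere: "fsphere m = sphere 0 1"
    by (simp add: fsphere_def)
  obtain k :: 'a where k: "k \<in> Basis"
    using nonempty_Basis by blast
  have "dim (UNIV :: 'b set) \<le> dim {x. k \<bullet> x = 0}"
    using dim by (simp add: dim_special_hyperplane[OF k])
  then obtain j :: "'b \<Rightarrow> 'a" where j: "linear j" "j \<in> UNIV \<rightarrow> {x. k \<bullet> x = 0}" "\<And>y. norm (j y) = norm y"
    using isometry_subset_subspace[OF subspace_UNIV subspace_hyperplane] by (metis UNIV_I)
  define F where "F x = sgn (j (h x))" for x
  have j_nz: "j (h x) \<noteq> 0" if "norm x = 1" for x
    using nz[OF that] j(3)[of "h x"] by auto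
  have F_cont: "continuous_on (sphere 0 1) F"
    unfolding F_def using j_nz
    by (intro continuous_on_sgn linear_continuous_on_compose[OF cont j(1)]) auto
  have F_im: "F \<in> sphere 0 1 \<rightarrow> sphere 0 1"
    using j_nz by (auto simp: F_def norm_sgn)
  have F_odd: "F (- x) = - F x" if "norm x = 1" for x
    using odd[OF that] by (simp add: F_def linear_neg[OF j(1)] sgn_minus)
  have "k \<bullet> F x = 0" for x
    using j(2) by (simp add: F_def sgn_div_norm Pi_iff)
  then have "k \<notin> F ` sphere 0 1"
    using k by (metis imageE inner_eq_zero_iff nonzero_Basis)
  then have "sphere_degree m F = 0"
    using F_cont F_im k by (intro sphere_degree_nonsurjective[OF m, of F k]) (simp_all add: sphere)
  moreover have "odd (sphere_degree m F)"
    using F_cont F_im F_odd by (intro odd_sphere_degree[OF m]) (simp_all add: sphere)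
  ultimately show False
    by simp
qed

section \<open>Smoothed bisectors that meet the supports\<close>

text \<open>
  For \<open>k > 0\<close>, an odd continuous approximation of \<open>sgn\<close>, equal to it outside \<open>(- 1 / k, 1 / k)\<close>.
\<close>

definition ramp :: "real \<Rightarrow> real \<Rightarrow> real" where
  "ramp k t = max (- 1) (min 1 (k * t))"

lemma ramp_minus: "ramp k (- t) = - ramp k t"
  by (auto simp: ramp_def max_def min_def)

lemma abs_ramp_le: "\<bar>ramp k t\<bar> \<le> 1"
  by (auto simp: ramp_def max_def min_def)

lemma ramp_saturated:
  assumes "0 < k" "1 / k \<le> \<bar>t\<bar>"
  shows "ramp k t = sgn t"
proof -
  have "1 \<le> k * \<bar>t\<bar>"
    using assms by (simp add: field_simps)
  then show ?thesis
    using assms(1) by (cases t "0 :: real" rule: linorder_cases) (auto simp: ramp_def)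
qed

lemma continuous_ramp: "continuous_on X (ramp k)"
  unfolding ramp_def[abs_def] by (intro continuous_intros)

lemma ramp_tendsto:
  assumes "filterlim k at_top sequentially" "t \<longlonglongrightarrow> l" "l \<noteq> 0"
  shows "(\<lambda>n. ramp (k n) (t n)) \<longlonglongrightarrow> sgn l"
proof -
  have pos: "(\<lambda>n. ramp (k n) (s n)) \<longlonglongrightarrow> 1" if "s \<longlonglongrightarrow> r" "0 < r" for s r
  proof -
    have "filterlim (\<lambda>n. s n * k n) at_top sequentially"
      by (rule filterlim_tendsto_pos_mult_at_top[OF that assms(1)])
    then have "\<forall>\<^sub>F n in sequentially. 1 \<le> s n * k n"
      by (simp add: filterlim_at_top)
    then show ?thesis
      by (intro tendsto_eventually) (auto elim!: eventually_mono simp: ramp_def mult.commute)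
  qed
  show ?thesis
  proof (cases "0 < l")
    case True
    then show ?thesis
      using pos[OF assms(2)] by simp
  next
    case False
    then show ?thesis
      using pos[OF tendsto_minus[OF assms(2)]] assms(3) tendsto_minus_cancel_left
      by (fastforce simp: ramp_minus)
  qed
qed

text \<open>
  By compactness, such a piece is cut out of \<open>K\<close> by a finite union of sets from a countable basis.
\<close>

lemma countable_relatively_clopen:
  fixes K :: "'a::second_countable_topology set"
  shows "countable {K \<inter> U | U. open U \<and> compact (K \<inter> U)}"
proof -
  obtain B :: "'a set set" where B: "countable B" "topological_basis B"
    using ex_countable_basis by blast
  have "{K \<inter> U | U. open U \<and> compact (K \<inter> U)} \<subseteq> (\<lambda>F. K \<inter> \<Union>F) ` {F. finite F \<and> F \<subseteq> B}"
  proof clarify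
    fix U :: "'a set" assume U: "open U" "compact (K \<inter> U)"
    obtain B' where B': "B' \<subseteq> B" "\<Union>B' = U"
      using B(2) U(1) by (auto simp: topological_basis_def)
    have "\<And>V. V \<in> B' \<Longrightarrow> open V"
      using B' B(2) topological_basis_open by blast
    then obtain F where F: "F \<subseteq> B'" "finite F" "K \<inter> U \<subseteq> \<Union>F"
      using compactE[OF U(2), of B'] B'(2) by blast
    then have "K \<inter> U = K \<inter> \<Union>F"
      using B'(2) by blast
    then show "K \<inter> U \<in> (\<lambda>F. K \<inter> \<Union>F) ` {F. finite F \<and> F \<subseteq> B}"
      using F B'(1) by blast
  qed
  moreover have "countable ((\<lambda>F. K \<inter> \<Union>F) ` {F. finite F \<and> F \<subseteq> B})"
    by (intro countable_image countable_Collect_finite_subset B(1))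
  ultimately show ?thesis
    by (rule countable_subset)
qed

lemma finite_borel_measureD:
  assumes "finite_borel_measure M"
  shows "finite_measure M" "sets M = sets borel" "space M = UNIV"
  using assms sets_eq_imp_space_eq[of M borel] by (auto simp: finite_borel_measure_def)

lemma AE_in_msupport:
  fixes M :: "'a::second_countable_topology measure"
  assumes "finite_borel_measure M"
  shows "AE x in M. x \<in> msupport M"
proof -
  interpret finite_measure M
    using assms by (rule finite_borel_measureD)
  note M = finite_borel_measureD[OF assms]
  have "msupport M \<in> sets M"
    using msupport_least(1)[OF assms] by (simp add: M borel_closed)
  then have "measure M (space M - msupport M) = 0"
    using finite_measure_compl msupport_least(2)[OF assms] M(3) by simp
  then have "space M - msupport M \<in> null_sets M"
    using \<open>msupport M \<in> sets M\<close> by (auto simp: null_sets_def emeasure_eq_measure)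
  then show ?thesis
    by (rule AE_I') auto
qed

lemma borel_measurable_ramp_inner [measurable]:
  fixes u :: "'a::euclidean_space"
  shows "(\<lambda>x. ramp k (u \<bullet> x - c)) \<in> borel_measurable borel"
  by (intro borel_measurable_continuous_onI continuous_on_compose2[OF continuous_ramp] continuous_intros) auto

lemma bounded_integrable:
  fixes f :: "'a::topological_space \<Rightarrow> real"
  assumes "finite_borel_measure M" "f \<in> borel_measurable borel" "\<And>x. \<bar>f x\<bar> \<le> 1"
  shows "integrable M f"
proof -
  interpret finite_measure M
    using assms by (intro finite_borel_measureD)
  show ?thesis
    using assms finite_borel_measureD[OF assms(1)]
    by (intro integrable_const_bound[of _ 1]) (auto cong: measurable_cong_sets)
qed

lemma continuous_ramp_integral:
  fixes M :: "'a::euclidean_space measure"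
  assumes M: "finite_borel_measure M"
  shows "continuous_on X (\<lambda>(u, c). \<integral>x. ramp k (u \<bullet> x - c) \<partial>M)"
proof (subst continuous_on_sequentially, intro allI ballI impI)
  interpret finite_measure M
    using M by (rule finite_borel_measureD)
  note [measurable_cong] = finite_borel_measureD(2)[OF M]
  fix p l assume "l \<in> X" and p: "(\<forall>n. p n \<in> X) \<and> p \<longlonglongrightarrow> (l :: 'a \<times> real)"
  have "(\<lambda>n. \<integral>x. ramp k (fst (p n) \<bullet> x - snd (p n)) \<partial>M) \<longlonglongrightarrow> (\<integral>x. ramp k (fst l \<bullet> x - snd l) \<partial>M)"
  proof (rule integral_dominated_convergence[where w = "\<lambda>_. 1"])
    have "(\<lambda>n. ramp k (fst (p n) \<bullet> x - snd (p n))) \<longlonglongrightarrow> ramp k (fst l \<bullet> x - snd l)" for x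
      using p by (intro continuous_on_tendsto_compose[OF continuous_ramp[of UNIV]] tendsto_intros) auto
    then show "AE x in M. (\<lambda>n. ramp k (fst (p n) \<bullet> x - snd (p n))) \<longlonglongrightarrow> ramp k (fst l \<bullet> x - snd l)"
      by simp
  qed (auto simp: abs_ramp_le)
  then show "((\<lambda>(u, c). \<integral>x. ramp k (u \<bullet> x - c) \<partial>M) \<circ> p) \<longlonglongrightarrow> (case l of (u, c) \<Rightarrow> \<integral>x. ramp k (u \<bullet> x - c) \<partial>M)"
    by (simp add: o_def case_prod_beta)
qed

text \<open>
  The pairs \<open>(u, c)\<close> range over the unit sphere of a space whose dimension exceeds the number of
  measures, so the Borsuk--Ulam theorem applies. The additional atom of weight \<open>\<delta> i\<close> at
  \<open>a i\<close> contributes the second summand. The case \<open>u = 0\<close> is not excluded here.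
\<close>

lemma perturbed_smooth_bisector:
  fixes M :: "'i::finite \<Rightarrow> 'a::euclidean_space measure" and a :: "'i \<Rightarrow> 'a" and \<delta> :: "'i \<Rightarrow> real"
  assumes "CARD('i) \<le> DIM('a)" and M: "\<And>i. finite_borel_measure (M i)"
  shows "\<exists>u c. norm (u, c :: real) = 1 \<and>
    (\<forall>i. (\<integral>x. ramp k (u \<bullet> x - c) \<partial>M i) + \<delta> i * ramp k (u \<bullet> a i - c) = 0)"
proof -
  define h :: "'a \<times> real \<Rightarrow> real ^ 'i" where
    "h p = (\<chi> i. (\<integral>x. ramp k (fst p \<bullet> x - snd p) \<partial>M i) + \<delta> i * ramp k (fst p \<bullet> a i - snd p))" for p
  have "continuous_on (sphere 0 1) h"
    unfolding h_def using continuous_ramp_integral[OF M, unfolded case_prod_beta]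
    by (intro continuous_intros continuous_on_compose2[OF continuous_ramp]) auto
  moreover have "h (- p) = - h p" for p
  proof -
    have neg: "ramp k (snd p - fst p \<bullet> x) = - ramp k (fst p \<bullet> x - snd p)" for x
      using ramp_minus[of k "fst p \<bullet> x - snd p"] by simp
    show ?thesis
      by (simp add: h_def vec_eq_iff neg)
  qed
  moreover have "DIM(real ^ 'i) < DIM('a \<times> real)"
    using assms(1) by simp
  ultimately obtain p where "norm p = 1" "h p = 0"
    using Borsuk_Ulam_zero by metis
  then show ?thesis
    by (intro exI[of _ "fst p"] exI[of _ "snd p"]) (simp add: h_def vec_eq_iff)
qed

text \<open>
  The weights \<open>\<delta> i\<close> are chosen outside the countable set of imbalances of relatively clopen
  subsets of the support. A slab that missed the support would realize \<open>\<delta> i\<close> as such an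
  imbalance.
\<close>

lemma approximate_bisector:
  fixes M :: "'i::finite \<Rightarrow> 'a::euclidean_space measure"
  assumes "CARD('i) \<le> DIM('a)" and M: "\<And>i. finite_borel_measure (M i)"
    and nonzero: "\<And>i. measure (M i) UNIV \<noteq> 0"
    and compact: "\<And>i. compact (msupport (M i))" and "0 < k"
  shows "\<exists>u c. norm (u, c :: real) = 1 \<and>
    (\<forall>i. \<bar>\<integral>x. ramp k (u \<bullet> x - c) \<partial>M i\<bar> \<le> 1 / k \<and>
      (\<exists>x\<in>msupport (M i). \<bar>u \<bullet> x - c\<bar> < 1 / k))"
proof -
  let ?K = "\<lambda>i. msupport (M i)"
  define pieces where "pieces i = {?K i \<inter> U | U. open U \<and> compact (?K i \<inter> U)}" for i
  define imbalance where "imbalance i A = \<bar>measure (M i) A - measure (M i) (?K i - A)\<bar>" for i A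
  have "\<exists>a \<delta>. a \<in> ?K i \<and> 0 < \<delta> \<and> \<delta> < 1 / k \<and> \<delta> \<notin> imbalance i ` pieces i" for i
  proof -
    have "?K i \<noteq> {}"
      using msupport_least(2)[OF M, of i] nonzero[of i] by (metis measure_empty)
    moreover have "countable (imbalance i ` pieces i)"
      unfolding pieces_def by (intro countable_image countable_relatively_clopen)
    then have "\<not> {0<..<1 / k} \<subseteq> imbalance i ` pieces i"
      using uncountable_open_interval[of 0 "1 / k"] \<open>0 < k\<close> countable_subset by auto
    ultimately show ?thesis
      by (auto simp: subset_iff)
  qed
  then obtain a \<delta> where a: "\<And>i. a i \<in> ?K i" and \<delta>: "\<And>i. 0 < \<delta> i" "\<And>i. \<delta> i < 1 / k"
    "\<And>i. \<delta> i \<notin> imbalance i ` pieces i"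
    by metis
  obtain u c where uc: "norm (u, c) = 1"
    and zero: "\<And>i. (\<integral>x. ramp k (u \<bullet> x - c) \<partial>M i) + \<delta> i * ramp k (u \<bullet> a i - c) = 0"
    using perturbed_smooth_bisector[where M = M and a = a and \<delta> = \<delta> and k = k, OF assms(1) M] by blast
  have "\<bar>\<integral>x. ramp k (u \<bullet> x - c) \<partial>M i\<bar> \<le> 1 / k" for i
  proof -
    have "\<bar>\<integral>x. ramp k (u \<bullet> x - c) \<partial>M i\<bar> = \<delta> i * \<bar>ramp k (u \<bullet> a i - c)\<bar>"
      using zero[of i] \<delta>(1)[of i] by (simp add: eq_neg_iff_add_eq_0[symmetric] abs_mult)
    also have "\<dots> \<le> \<delta> i * 1"
      using \<delta>(1)[of i] by (intro mult_left_mono abs_ramp_le) simp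
    finally show ?thesis
      using \<delta>(2)[of i] by simp
  qed
  moreover have "\<exists>x\<in>?K i. \<bar>u \<bullet> x - c\<bar> < 1 / k" for i
  proof (rule ccontr)
    interpret finite_measure "M i"
      using M by (rule finite_borel_measureD)
    assume "\<not> ?thesis"
    then have far: "1 / k \<le> \<bar>u \<bullet> x - c\<bar>" if "x \<in> ?K i" for x
      using that by (force simp: not_less)
    \<comment> \<open>With an empty slab, the strict and the shifted weak inequality cut out the same piece,
      which is therefore relatively open and compact.\<close>
    define A where "A = ?K i \<inter> {x. c < u \<bullet> x}"
    have "A = ?K i \<inter> {x. c + 1 / k \<le> u \<bullet> x}"
      using far \<open>0 < k\<close> by (force simp: A_def abs_if split: if_splits intro: less_le_trans[of c "c + 1 / k"])
    then have "compact A"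
      using compact by (simp add: compact_Int_closed closed_halfspace_ge)
    then have "A \<in> pieces i"
      using open_halfspace_gt[of c u] by (auto simp: pieces_def A_def)
    have [measurable]: "?K i \<in> sets borel" "A \<in> sets borel"
      using compact \<open>compact A\<close> by (simp_all add: borel_compact)
    note [measurable_cong] = finite_borel_measureD(2)[OF M]
    have "(\<integral>x. ramp k (u \<bullet> x - c) \<partial>M i) = (\<integral>x. indicator A x - indicator (?K i - A) x \<partial>M i)"
    proof (rule integral_cong_AE)
      show "AE x in M i. ramp k (u \<bullet> x - c) = indicator A x - indicator (?K i - A) x"
        using AE_in_msupport[OF M]
      proof eventually_elim
        case (elim x)
        then show ?case
          using ramp_saturated[OF \<open>0 < k\<close> far[OF elim]] far[OF elim] \<open>0 < k\<close>
          by (auto simp: A_def sgn_real_def indicator_def)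
      qed
    qed measurable
    also have "\<dots> = measure (M i) A - measure (M i) (?K i - A)"
      by (subst Bochner_Integration.integral_diff)
        (auto simp: finite_borel_measureD[OF M] intro!: integrable_real_indicator simp: emeasure_eq_measure)
    finally have "measure (M i) A - measure (M i) (?K i - A) = - (\<delta> i * sgn (u \<bullet> a i - c))"
      using zero[of i] ramp_saturated[OF \<open>0 < k\<close> far[OF a]] by simp
    moreover have "u \<bullet> a i - c \<noteq> 0"
      using far[OF a] \<open>0 < k\<close> by (metis abs_zero divide_pos_pos not_le zero_less_one)
    ultimately have "imbalance i A = \<delta> i"
      using \<delta>(1)[of i] by (simp add: imbalance_def abs_mult abs_sgn_eq)
    then show False
      using \<delta>(3)[of i] \<open>A \<in> pieces i\<close> by (metis imageI)
  qed
  ultimately show ?thesis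
    using uc by blast
qed

section \<open>Passage to the limit\<close>

text \<open>
  Off the limit hyperplane \<open>H\<close> the ramps converge to the sign, by dominated convergence also in mean.
  On \<open>H\<close> they may do anything between \<open>- 1\<close> and 1, so the masses of the two sides differ by at most
  the mass of \<open>H\<close>, and this is equivalent to bisection.
\<close>

lemma bisects_limit:
  fixes M :: "'a::euclidean_space measure"
  assumes M: "finite_borel_measure M"
    and k: "filterlim k at_top sequentially"
    and u: "u \<longlonglongrightarrow> u'" and c: "c \<longlonglongrightarrow> c'"
    and balanced: "(\<lambda>n. \<integral>x. ramp (k n) (u n \<bullet> x - c n) \<partial>M) \<longlonglongrightarrow> 0"
  shows "bisects u' c' M"
proof -
  interpret finite_measure M
    using M by (rule finite_borel_measureD)
  note [measurable_cong] = finite_borel_measureD(2)[OF M]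
  note space = finite_borel_measureD(3)[OF M]
  let ?H = "hyperplane u' c'" and ?P = "pos_side u' c'" and ?N = "neg_side u' c'"
  have sets: "?H \<in> sets M" "?P \<in> sets M" "?N \<in> sets M"
    unfolding hyperplane_def pos_side_def neg_side_def finite_borel_measureD(2)[OF M]
    using closed_hyperplane[of u' c'] open_halfspace_gt[of c' u'] open_halfspace_lt[of u' c']
    by (auto intro: borel_closed borel_open)
  then have [measurable]: "?H \<in> sets borel"
    by (simp add: finite_borel_measureD(2)[OF M])
  have int_ind: "integrable M (indicator A :: 'a \<Rightarrow> real)" if "A \<in> sets M" for A
    using that by (simp add: emeasure_eq_measure)
  have int_ramp: "integrable M (\<lambda>x. ramp (k n) (u n \<bullet> x - c n))" for n
    by (intro bounded_integrable[OF M] abs_ramp_le) measurable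
  define g where "g n x = ramp (k n) (u n \<bullet> x - c n) * indicator (- ?H) x" for n x
  have "(\<lambda>n. \<integral>x. g n x \<partial>M) \<longlonglongrightarrow> (\<integral>x. indicator ?P x - indicator ?N x \<partial>M)"
  proof (rule integral_dominated_convergence[where w = "\<lambda>_. 1"])
    have "(\<lambda>n. g n x) \<longlonglongrightarrow> indicator ?P x - indicator ?N x" for x
    proof (cases "x \<in> ?H")
      case False
      then have "u' \<bullet> x - c' \<noteq> 0"
        by (simp add: hyperplane_def)
      moreover have "(\<lambda>n. u n \<bullet> x - c n) \<longlonglongrightarrow> u' \<bullet> x - c'"
        by (intro tendsto_intros u c)
      ultimately have "(\<lambda>n. ramp (k n) (u n \<bullet> x - c n)) \<longlonglongrightarrow> sgn (u' \<bullet> x - c')"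
        using ramp_tendsto[OF k] by blast
      then show ?thesis
        using False by (auto simp: g_def hyperplane_def pos_side_def neg_side_def indicator_def sgn_real_def split: if_splits)
    qed (simp add: g_def hyperplane_def pos_side_def neg_side_def)
    then show "AE x in M. (\<lambda>n. g n x) \<longlonglongrightarrow> indicator ?P x - indicator ?N x"
      by simp
    show "AE x in M. norm (g n x) \<le> 1" for n
      by (auto simp: g_def indicator_def abs_ramp_le)
  qed (use sets in \<open>auto simp: g_def\<close>)
  also have "(\<integral>x. indicator ?P x - indicator ?N x \<partial>M) = measure M ?P - measure M ?N"
    using sets by (subst Bochner_Integration.integral_diff) (auto simp: int_ind space)
  finally have lim: "(\<lambda>n. \<bar>(\<integral>x. g n x \<partial>M) - (\<integral>x. ramp (k n) (u n \<bullet> x - c n) \<partial>M)\<bar>)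
      \<longlonglongrightarrow> \<bar>measure M ?P - measure M ?N - 0\<bar>"
    using balanced by (intro tendsto_intros)
  have "\<bar>(\<integral>x. g n x \<partial>M) - (\<integral>x. ramp (k n) (u n \<bullet> x - c n) \<partial>M)\<bar> \<le> measure M ?H" for n
  proof -
    have "g n \<in> borel_measurable borel"
      unfolding g_def[abs_def] by measurable
    then have "integrable M (g n)"
      by (rule bounded_integrable[OF M]) (auto simp: g_def indicator_def abs_ramp_le)
    then have "\<bar>(\<integral>x. g n x \<partial>M) - (\<integral>x. ramp (k n) (u n \<bullet> x - c n) \<partial>M)\<bar>
        = \<bar>\<integral>x. g n x - ramp (k n) (u n \<bullet> x - c n) \<partial>M\<bar>"
      using int_ramp by simp
    also have "\<dots> \<le> (\<integral>x. \<bar>g n x - ramp (k n) (u n \<bullet> x - c n)\<bar> \<partial>M)"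
      by (rule integral_abs_bound)
    also have "\<dots> \<le> (\<integral>x. indicator ?H x \<partial>M)"
    proof (rule integral_mono)
      show "integrable M (\<lambda>x. \<bar>g n x - ramp (k n) (u n \<bullet> x - c n)\<bar>)"
        by (intro integrable_abs Bochner_Integration.integrable_diff \<open>integrable M (g n)\<close> int_ramp)
      show "integrable M (indicator ?H :: 'a \<Rightarrow> real)"
        by (rule int_ind) (rule sets(1))
    qed (simp add: g_def indicator_def abs_ramp_le)
    finally show ?thesis
      by (simp add: space)
  qed
  then have "\<bar>measure M ?P - measure M ?N\<bar> \<le> measure M ?H"
    using LIMSEQ_le_const2[OF lim] by auto
  moreover have "measure M UNIV = measure M ?P + (measure M ?H + measure M ?N)"
  proof -
    have "UNIV = ?P \<union> (?H \<union> ?N)" "?P \<inter> (?H \<union> ?N) = {}" "?H \<inter> ?N = {}"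
      by (auto simp: pos_side_def neg_side_def hyperplane_def)
    then show ?thesis
      using finite_measure_Union[of ?P "?H \<union> ?N"] finite_measure_Union[of ?H ?N] sets by auto
  qed
  ultimately show ?thesis
    unfolding bisects_def by auto
qed

lemma hyperplane_meets_limit:
  fixes K :: "'a::euclidean_space set"
  assumes "compact K" and u: "u \<longlonglongrightarrow> u'" and c: "c \<longlonglongrightarrow> c'"
    and x: "\<And>n. x n \<in> K" and near: "(\<lambda>n. u n \<bullet> x n - c n) \<longlonglongrightarrow> 0"
  shows "hyperplane u' c' \<inter> K \<noteq> {}"
proof -
  obtain l r where l: "l \<in> K" and r: "strict_mono r" "(x \<circ> r) \<longlonglongrightarrow> l"
    using \<open>compact K\<close> x unfolding compact_def by metis
  have sub: "(f \<circ> r) \<longlonglongrightarrow> z" if "f \<longlonglongrightarrow> z" for f and z :: "'b::topological_space"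
    using LIMSEQ_subseq_LIMSEQ[OF that r(1)] .
  have "(\<lambda>n. (u \<circ> r) n \<bullet> (x \<circ> r) n - (c \<circ> r) n) \<longlonglongrightarrow> u' \<bullet> l - c'"
    by (intro tendsto_intros sub u c r(2))
  moreover have "(\<lambda>n. (u \<circ> r) n \<bullet> (x \<circ> r) n - (c \<circ> r) n) \<longlonglongrightarrow> 0"
    using LIMSEQ_subseq_LIMSEQ[OF near r(1)] by (simp add: o_def)
  ultimately have "u' \<bullet> l - c' = 0"
    by (rule LIMSEQ_unique)
  then show ?thesis
    using l by (auto simp: hyperplane_def)
qed

lemma hyperplane_scale:
  assumes "s \<noteq> 0"
  shows "hyperplane (s *\<^sub>R u) (s * c) = hyperplane u c"
  using assms by (simp add: hyperplane_def)

lemma bisects_scale: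
  assumes "s \<noteq> 0"
  shows "bisects (s *\<^sub>R u) (s * c) M \<longleftrightarrow> bisects u c M"
proof (cases "0 < s")
  case True
  then show ?thesis
    by (simp add: bisects_def pos_side_def neg_side_def)
next
  case False
  then have "s < 0"
    using assms by simp
  then show ?thesis
    by (auto simp: bisects_def pos_side_def neg_side_def)
qed

text \<open>
  The limit pair \<open>(u, c)\<close> has norm 1, and \<open>u = 0\<close> would force \<open>c = 0\<close> because the set
  \<open>0 \<bullet> x = c\<close> contains a point of a support. Hence \<open>u\<close> can be normalized, and the sign of the scaling factor
  makes \<open>c\<close> nonnegative.
\<close>

theorem ham_sandwich_meeting_supports:
  fixes M :: "'i::finite \<Rightarrow> 'a::euclidean_space measure"
  assumes "CARD('i) \<le> DIM('a)" and M: "\<And>i. finite_borel_measure (M i)"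
    and nonzero: "\<And>i. measure (M i) UNIV \<noteq> 0"
    and compact: "\<And>i. compact (msupport (M i))"
  obtains u c where "norm u = 1" "0 \<le> c"
    "\<And>i. bisects u c (M i)" "\<And>i. hyperplane u c \<inter> msupport (M i) \<noteq> {}"
proof -
  define k where "k n = real (Suc n)" for n
  have k: "filterlim k at_top sequentially"
    unfolding k_def[abs_def] by (rule filterlim_compose[OF filterlim_real_sequentially filterlim_Suc])
  have k_pos: "0 < k n" for n
    by (simp add: k_def)
  have inverse_k: "(\<lambda>n. 1 / k n) \<longlonglongrightarrow> 0"
    using LIMSEQ_inverse_real_of_nat by (simp add: k_def inverse_eq_divide)
  have "\<exists>p. norm p = 1 \<and> (\<forall>i. \<bar>\<integral>x. ramp (k n) (fst p \<bullet> x - snd p) \<partial>M i\<bar> \<le> 1 / k n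
      \<and> (\<exists>x\<in>msupport (M i). \<bar>fst p \<bullet> x - snd p\<bar> < 1 / k n))" for n
    using approximate_bisector[where M = M and k = "k n", OF assms k_pos[of n]] by simp
  then obtain p where p: "\<And>n. norm (p n) = 1"
    and balanced: "\<And>n i. \<bar>\<integral>x. ramp (k n) (fst (p n) \<bullet> x - snd (p n)) \<partial>M i\<bar> \<le> 1 / k n"
    and near: "\<And>n i. \<exists>x\<in>msupport (M i). \<bar>fst (p n) \<bullet> x - snd (p n)\<bar> < 1 / k n"
    by metis
  obtain y where y: "\<And>n i. y i n \<in> msupport (M i)" "\<And>n i. \<bar>fst (p n) \<bullet> y i n - snd (p n)\<bar> < 1 / k n"
    using near by metis
  have "\<forall>n. p n \<in> sphere 0 1"
    using p by simp
  then obtain l r where l: "norm l = 1" and r: "strict_mono r" "(p \<circ> r) \<longlonglongrightarrow> l"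
    using compact_sphere[of "0 :: 'a \<times> real" 1] unfolding compact_def by (metis mem_sphere_0)
  define u c where "u = fst l" and "c = snd l"
  have u: "(\<lambda>n. fst (p (r n))) \<longlonglongrightarrow> u" and c: "(\<lambda>n. snd (p (r n))) \<longlonglongrightarrow> c"
    using tendsto_fst[OF r(2)] tendsto_snd[OF r(2)] by (simp_all add: u_def c_def o_def)
  have kr: "filterlim (\<lambda>n. k (r n)) at_top sequentially"
    using filterlim_compose[OF k filterlim_subseq[OF r(1)]] .
  have inverse_kr: "(\<lambda>n. 1 / k (r n)) \<longlonglongrightarrow> 0"
    using LIMSEQ_subseq_LIMSEQ[OF inverse_k r(1)] by (simp add: o_def)
  have bis: "bisects u c (M i)" for i
    by (rule bisects_limit[OF M kr u c], rule Lim_null_comparison[OF _ inverse_kr])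
      (simp add: balanced)
  have meets: "hyperplane u c \<inter> msupport (M i) \<noteq> {}" for i
  proof (rule hyperplane_meets_limit[OF compact u c y(1)])
    show "(\<lambda>n. fst (p (r n)) \<bullet> y i (r n) - snd (p (r n))) \<longlonglongrightarrow> 0"
      by (rule Lim_null_comparison[OF _ inverse_kr]) (simp add: y(2) less_imp_le)
  qed
  have "u \<noteq> 0"
  proof
    assume "u = 0"
    then have "c = 0"
      using meets[of undefined] by (auto simp: hyperplane_def)
    then show False
      using l \<open>u = 0\<close> by (metis u_def c_def norm_zero prod.collapse zero_neq_one zero_prod_def)
  qed
  define s where "s = (if 0 \<le> c then 1 else - 1) / norm u"
  have "s \<noteq> 0" "norm (s *\<^sub>R u) = 1" "0 \<le> s * c"
    using \<open>u \<noteq> 0\<close> by (auto simp: s_def zero_le_mult_iff)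
  then show thesis
    using that[of "s *\<^sub>R u" "s * c"] bis meets by (simp add: hyperplane_scale bisects_scale)
qed

theorem theorem5:
  fixes \<mu> :: "nat \<Rightarrow> (real ^ 'n) measure"
  assumes "\<And>i. i \<in> {1..CARD('n)} \<Longrightarrow> finite_borel_measure (\<mu> i)"
    and "\<And>i. i \<in> {1..CARD('n)} \<Longrightarrow> measure (\<mu> i) UNIV \<noteq> 0"
    and "\<And>i. i \<in> {1..CARD('n)} \<Longrightarrow> compact (msupport (\<mu> i))"
  shows "\<exists>u c. norm u = 1 \<and> c \<ge> 0 \<and>
    (\<forall>i\<in>{1..CARD('n)}. bisects u c (\<mu> i) \<and> hyperplane u c \<inter> msupport (\<mu> i) \<noteq> {})"
proof -
  obtain g where g: "bij_betw g (UNIV :: 'n set) {1..CARD('n)}"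
    using finite_same_card_bij[of "UNIV :: 'n set" "{1..CARD('n)}"] by auto
  then have in_range: "g j \<in> {1..CARD('n)}" for j
    by (auto simp: bij_betw_def)
  obtain u c where "norm u = 1" "0 \<le> c"
    "\<And>j. bisects u c (\<mu> (g j))" "\<And>j. hyperplane u c \<inter> msupport (\<mu> (g j)) \<noteq> {}"
    using ham_sandwich_meeting_supports[of "\<lambda>j. \<mu> (g j)"] in_range assms by auto
  moreover have "\<exists>j. i = g j" if "i \<in> {1..CARD('n)}" for i
    using g that by (auto simp: bij_betw_def)
  ultimately show ?thesis
    by metis
qed

end
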